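(* Let $j \ge k$ be positive integers. For any bipartite digraph $D$ whose longest dipath has length $3$, we have $j+k \le \vec{\lambda}_{j,k}(D) \le j+2k$.
   Context: All digraphs are finite and strongly simple: they have no loops, no multiple edges, and never contain both edges $xy$ and $yx$. In a digraph $D$, $xy\in E(D)$ denotes an edge directed from $x$ to $y$, and then $x$ is adjacent to $y$. A dipath of length $\ell$ is a sequence of $\ell+1$ distinct vertices $v_0,v_1,\dots,v_\ell$ with $v_iv_{i+1}\in E(D)$ for all $0\le i<\ell$. "The longest dipath has length $m$" means that the maximum length of a dipath in $D$ is $m$. The distance $d_D(x,y)$ is the length of a shortest dipath from $x$ to $y$ (if one exists). For positive integers $j\ge k$, an $L(j,k)$-labeling of $D$ is a function $f$ from $V(D)$ to the nonnegative integers such that $|f(x)-f(y)|\ge j$ whenever $xy\in E(D)$ and $|f(x)-f(y)|\ge k$ whenever $d_D(x,y)=2$. The number $\vec{\lambda}_{j,k}(D)$ is the minimum, over all $L(j,k)$-labelings $f$ of $D$, of the span of $f$ (largest label minus smallest label). Equivalently, it is the minimum over all $L(j,k)$-labelings of the maximum label used. A digraph is bipartite if its underlying (undirected) graph is bipartite. *)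

theory Defs
  imports
    "Graph_Theory.Vertex_Walk"
    "Graph_Theory.Digraph_Component"
    "HOL-Library.Extended_Nat"
begin

locale strongly_simple_digraph = digraph +
  assumes no_opposite_arcs: "u \<rightarrow> v \<Longrightarrow> \<not> v \<rightarrow> u"

text \<open>
  A dipath is a \<^const>\<open>vpath\<close>: a nonempty list of distinct vertices in which consecutive
  vertices are joined by a forward arc. Its length \<^const>\<open>vwalk_length\<close> is the number of arcs.
\<close>

definition longest_dipath_length :: "('a,'b) pre_digraph \<Rightarrow> nat \<Rightarrow> bool" where
  "longest_dipath_length D m \<longleftrightarrow>
     (\<exists>p. vpath p D \<and> vwalk_length p = m) \<and>
     (\<forall>p. vpath p D \<longrightarrow> vwalk_length p \<le> m)"

text \<open>The value is \<open>\<infinity>\<close> if there is no dipath from \<open>x\<close> to \<open>y\<close>.\<close>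

definition didist :: "('a,'b) pre_digraph \<Rightarrow> 'a \<Rightarrow> 'a \<Rightarrow> enat" where
  "didist D x y = (INF p \<in> {p. vpath p D \<and> hd p = x \<and> last p = y}. enat (vwalk_length p))"

definition bipartite_graph :: "('a,'b) pre_digraph \<Rightarrow> bool" where
  "bipartite_graph G \<longleftrightarrow>
     (\<exists>U V. verts G = U \<union> V \<and> U \<inter> V = {} \<and>
        (\<forall>x y. x \<rightarrow>\<^bsub>G\<^esub> y \<longrightarrow> x \<in> U \<and> y \<in> V \<or> x \<in> V \<and> y \<in> U))"

text \<open>
  Undirected graphs are symmetric digraphs, so \<^const>\<open>mk_symmetric\<close> yields the underlying graph.
\<close>

definition bipartite_digraph :: "('a,'b) pre_digraph \<Rightarrow> bool" where
  "bipartite_digraph D \<longleftrightarrow> bipartite_graph (with_proj (mk_symmetric D))"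

definition L_labeling :: "nat \<Rightarrow> nat \<Rightarrow> ('a,'b) pre_digraph \<Rightarrow> ('a \<Rightarrow> nat) \<Rightarrow> bool" where
  "L_labeling j k D f \<longleftrightarrow>
     (\<forall>x\<in>verts D. \<forall>y\<in>verts D.
        (x \<rightarrow>\<^bsub>D\<^esub> y \<longrightarrow> \<bar>int (f x) - int (f y)\<bar> \<ge> int j) \<and>
        (didist D x y = 2 \<longrightarrow> \<bar>int (f x) - int (f y)\<bar> \<ge> int k))"

text \<open>Only meaningful for digraphs with a finite nonempty vertex set.\<close>

definition label_span :: "('a,'b) pre_digraph \<Rightarrow> ('a \<Rightarrow> nat) \<Rightarrow> nat" where
  "label_span D f = Max (f ` verts D) - Min (f ` verts D)"

definition L_number :: "nat \<Rightarrow> nat \<Rightarrow> ('a,'b) pre_digraph \<Rightarrow> nat" where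
  "L_number j k D = (LEAST s. \<exists>f. L_labeling j k D f \<and> label_span D f = s)"

text \<open>The minimum is taken over a nonempty set: a labeling always exists.\<close>

lemma L_labeling_exists:
  fixes D :: "('a,'b) pre_digraph"
  assumes "digraph D"
  shows "\<exists>f. L_labeling j k D f"
proof -
  interpret digraph D by fact
  obtain g :: "'a \<Rightarrow> nat" where g: "inj_on g (verts D)"
    using finite_imp_inj_to_nat_seg[OF finite_verts] by blast
  define f where "f x = (j + k) * g x" for x
  have sep: "\<bar>int (f x) - int (f y)\<bar> \<ge> int (j + k)"
    if "x \<in> verts D" "y \<in> verts D" "x \<noteq> y" for x y
  proof -
    have "g x \<noteq> g y" using that g by (auto dest: inj_onD)
    then have "\<bar>int (g x) - int (g y)\<bar> \<ge> 1" by linarith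
    then have "int (j + k) * \<bar>int (g x) - int (g y)\<bar> \<ge> int (j + k) * 1"
      by (intro mult_left_mono) auto
    also have "int (j + k) * \<bar>int (g x) - int (g y)\<bar> = \<bar>int (f x) - int (f y)\<bar>"
      unfolding f_def of_nat_mult right_diff_distrib[symmetric] abs_mult by simp
    finally show ?thesis by simp
  qed
  have loop: "didist D x x \<noteq> 2" if "x \<in> verts D" for x
  proof -
    have "vpath [x] D" using that by (auto simp: vpath_def vwalk_def)
    then have "didist D x x \<le> enat (vwalk_length [x])"
      unfolding didist_def by (intro INF_lower) auto
    then show ?thesis by (auto simp: zero_enat_def[symmetric])
  qed
  have "L_labeling j k D f"
    unfolding L_labeling_def
  proof (intro ballI conjI impI)
    fix x y assume xy: "x \<in> verts D" "y \<in> verts D"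
    { assume "x \<rightarrow>\<^bsub>D\<^esub> y"
      then have "x \<noteq> y" using adj_not_same by auto
      then show "\<bar>int (f x) - int (f y)\<bar> \<ge> int j" using sep[OF xy] by simp }
    { assume "didist D x y = 2"
      then have "x \<noteq> y" using loop xy by auto
      then show "\<bar>int (f x) - int (f y)\<bar> \<ge> int k" using sep[OF xy] by simp }
  qed
  then show ?thesis by blast
qed

end

theory Submission
  imports Defs
begin

text \<open>
  Write \<open>x \<Rightarrow> y\<close> if there are arcs \<open>x \<rightarrow> m \<rightarrow> y\<close>. In a bipartite strongly simple digraph such
  \<open>x\<close> and \<open>y\<close> are distinct and lie on the same side, hence are not adjacent, so \<open>x \<Rightarrow> y\<close> says
  exactly that the distance from \<open>x\<close> to \<open>y\<close> is \<open>2\<close> (\<open>didist_eq_2_iff\<close>).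

  Lower bound: a dipath of length \<open>3\<close> contains arcs \<open>x \<rightarrow> m \<rightarrow> y\<close>. If the label of \<open>m\<close> is between
  the other two, the labels spread over \<open>2j \<ge> j + k\<close>. Otherwise it lies below both or above both,
  at distance at least \<open>j\<close> from each of two labels that differ by at least \<open>k\<close>, which forces
  \<open>j + k\<close>.

  Upper bound: label one side from \<open>{0, k}\<close> and the other side from \<open>{j + k, j + 2k}\<close>. The
  conditions on arcs then hold automatically, and what remains is to 2-colour the vertices so that
  \<open>x \<Rightarrow> y\<close> implies different colours. If \<open>x \<Rightarrow> y \<Rightarrow> z\<close>, the five vertices of the walk would be a
  dipath of length \<open>4\<close> unless \<open>x = z\<close>, in which case they form a directed 4-cycle
  (\<open>two_step_returns\<close>). So in the relation \<open>\<Rightarrow>\<close> a vertex is a source, or a sink, or one half of an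
  isolated pair \<open>x \<Rightarrow> y \<Rightarrow> x\<close>, and such a relation is 2-colourable (\<open>two_coloring\<close>).
\<close>

definition two_step :: "('a,'b) pre_digraph \<Rightarrow> 'a \<Rightarrow> 'a \<Rightarrow> bool" where
  "two_step D x y \<longleftrightarrow> (\<exists>m. x \<rightarrow>\<^bsub>D\<^esub> m \<and> m \<rightarrow>\<^bsub>D\<^esub> y)"

lemma bipartite_digraphE:
  assumes "bipartite_digraph D"
  obtains B where "\<And>x y. x \<rightarrow>\<^bsub>D\<^esub> y \<Longrightarrow> x \<in> B \<longleftrightarrow> y \<notin> B"
proof -
  let ?G = "with_proj (mk_symmetric D)"
  have sym: "x \<rightarrow>\<^bsub>?G\<^esub> y" if "x \<rightarrow>\<^bsub>D\<^esub> y" for x y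
    using that by (auto simp: parcs_mk_symmetric arcs_ends_conv)
  obtain U V where "U \<inter> V = {}"
    and "\<forall>x y. x \<rightarrow>\<^bsub>?G\<^esub> y \<longrightarrow> x \<in> U \<and> y \<in> V \<or> x \<in> V \<and> y \<in> U"
    using assms unfolding bipartite_digraph_def bipartite_graph_def by blast
  with sym have "\<And>x y. x \<rightarrow>\<^bsub>D\<^esub> y \<Longrightarrow> x \<in> U \<longleftrightarrow> y \<notin> U"
    by blast
  then show thesis by (rule that)
qed

lemma vwalk_length_2_conv: "vwalk_length p = 2 \<longleftrightarrow> (\<exists>x m y. p = [x, m, y])"
  by (cases p rule: list.exhaust) (auto simp: length_Suc_conv numeral_2_eq_2)

lemma two_step_if_didist_2:
  assumes "didist D x y = 2"
  shows "two_step D x y"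
proof -
  let ?P = "{p. vpath p D \<and> hd p = x \<and> last p = y}"
  let ?L = "(\<lambda>p. enat (vwalk_length p)) ` ?P"
  have "?L \<noteq> {}"
  proof
    assume "?L = {}"
    then have "didist D x y = Inf {}"
      unfolding didist_def by (rule arg_cong)
    with assms show False by (simp add: top_enat_def)
  qed
  \<comment> \<open>the infimum is attained, since \<^typ>\<open>enat\<close> is well-ordered\<close>
  then have "Inf ?L \<in> ?L"
    unfolding Inf_enat_def by (metis (mono_tags, lifting) LeastI_ex equals0I)
  then obtain p where p: "vpath p D" "hd p = x" "last p = y" "enat (vwalk_length p) = 2"
    using assms unfolding didist_def by auto
  then have "vwalk_length p = 2"
    by (simp add: numeral_eq_enat)
  then obtain a m b where "p = [a, m, b]"
    unfolding vwalk_length_2_conv by blast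
  with p show ?thesis
    by (auto simp: two_step_def vpath_def vwalk_def)
qed

lemma didist_eq_2_iff:
  assumes "strongly_simple_digraph D" "bipartite_digraph D"
  shows "didist D x y = 2 \<longleftrightarrow> two_step D x y"
proof
  show "two_step D x y" if "didist D x y = 2"
    using that by (rule two_step_if_didist_2)
next
  interpret strongly_simple_digraph D by fact
  assume "two_step D x y"
  then obtain m where m: "x \<rightarrow>\<^bsub>D\<^esub> m" "m \<rightarrow>\<^bsub>D\<^esub> y"
    unfolding two_step_def by blast
  obtain B where B: "\<And>x y. x \<rightarrow>\<^bsub>D\<^esub> y \<Longrightarrow> x \<in> B \<longleftrightarrow> y \<notin> B"
    using assms(2) by (rule bipartite_digraphE) blast
  have "x \<noteq> y"
    using m no_opposite_arcs by blast
  have "\<not> x \<rightarrow>\<^bsub>D\<^esub> y"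
    using m B by blast
  have "vpath [x, m, y] D"
    using m \<open>x \<noteq> y\<close> adj_not_same by (auto simp: vpath_def vwalk_def)
  then have "didist D x y \<le> enat (vwalk_length [x, m, y])"
    unfolding didist_def by (intro INF_lower) auto
  moreover have "2 \<le> enat (vwalk_length p)"
    if "vpath p D" "hd p = x" "last p = y" for p
  proof -
    have "vwalk_length p \<noteq> 0" "vwalk_length p \<noteq> 1"
      using that \<open>x \<noteq> y\<close> \<open>\<not> x \<rightarrow>\<^bsub>D\<^esub> y\<close>
      by (cases p; cases "tl p"; auto simp: vpath_def vwalk_def)+
    then have "2 \<le> vwalk_length p" by linarith
    then show ?thesis by (simp add: numeral_eq_enat)
  qed
  then have "2 \<le> didist D x y"
    unfolding didist_def by (intro INF_greatest) auto
  ultimately show "didist D x y = 2"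
    by (intro antisym) (simp_all add: numeral_eq_enat numeral_2_eq_2)
qed

text \<open>
  Whichever of the three labels is in the middle, the gaps around it add up to at least \<open>j + k\<close>:
  they are at least \<open>j\<close> and \<open>j\<close> when it is the label of \<open>m\<close>, and at least \<open>j\<close> and \<open>k\<close> otherwise.
\<close>

lemma label_span_ge:
  assumes "digraph D" "L_labeling j k D f" "k \<le> j"
    and xm: "x \<rightarrow>\<^bsub>D\<^esub> m" and my: "m \<rightarrow>\<^bsub>D\<^esub> y" and "didist D x y = 2"
  shows "j + k \<le> label_span D f"
proof -
  interpret digraph D by fact
  have V: "x \<in> verts D" "m \<in> verts D" "y \<in> verts D"
    using xm my by auto
  have "\<bar>int (f x) - int (f m)\<bar> \<ge> int j" "\<bar>int (f m) - int (f y)\<bar> \<ge> int j"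
    "\<bar>int (f x) - int (f y)\<bar> \<ge> int k"
    using assms V unfolding L_labeling_def by blast+
  moreover have "Min (f ` verts D) \<le> f v \<and> f v \<le> Max (f ` verts D)" if "v \<in> verts D" for v
    using that by simp
  note this[OF V(1)] this[OF V(2)] this[OF V(3)]
  ultimately show ?thesis
    unfolding label_span_def using \<open>k \<le> j\<close> by linarith
qed

text \<open>
  A closed walk is the only way for two consecutive two-steps to avoid a dipath of length \<open>4\<close>:
  bipartiteness and the absence of opposite arcs rule out all other coincidences.
\<close>

lemma two_step_returns:
  assumes "strongly_simple_digraph D" "bipartite_digraph D"
    and short: "\<And>p. vpath p D \<Longrightarrow> vwalk_length p < 4"
    and "two_step D x y" "two_step D y z"
  shows "z = x"
proof (rule ccontr)
  assume "z \<noteq> x"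
  interpret strongly_simple_digraph D by fact
  obtain m n where arcs: "x \<rightarrow>\<^bsub>D\<^esub> m" "m \<rightarrow>\<^bsub>D\<^esub> y" "y \<rightarrow>\<^bsub>D\<^esub> n" "n \<rightarrow>\<^bsub>D\<^esub> z"
    using assms(4,5) unfolding two_step_def by blast
  obtain B where B: "\<And>x y. x \<rightarrow>\<^bsub>D\<^esub> y \<Longrightarrow> x \<in> B \<longleftrightarrow> y \<notin> B"
    using assms(2) by (rule bipartite_digraphE) blast
  have "x \<noteq> m" "x \<noteq> n" "y \<noteq> m" "y \<noteq> n" "z \<noteq> m" "z \<noteq> n"
    using arcs[THEN B] by blast+
  moreover have "x \<noteq> y" "y \<noteq> z" "m \<noteq> n"
    using arcs no_opposite_arcs by blast+
  ultimately have "vpath [x, m, y, n, z] D"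
    using arcs \<open>z \<noteq> x\<close> by (auto simp: vpath_def vwalk_def)
  from short[OF this] show False by simp
qed

text \<open>
  A vertex gets the colour \<^const>\<open>True\<close> if it is a source of the relation. Isolated pairs
  \<open>x \<Rightarrow> y \<Rightarrow> x\<close> are symmetric, so there an injective numbering decides which of the two counts as
  the source.
\<close>

lemma two_coloring:
  fixes R :: "'a \<Rightarrow> 'a \<Rightarrow> bool"
  assumes "finite V" and V: "\<And>x y. R x y \<Longrightarrow> x \<in> V \<and> y \<in> V"
    and irrefl: "\<And>x. \<not> R x x"
    and returns: "\<And>x y z. R x y \<Longrightarrow> R y z \<Longrightarrow> z = x"
  shows "\<exists>c :: 'a \<Rightarrow> bool. \<forall>x y. R x y \<longrightarrow> c x \<noteq> c y"
proof -
  obtain g :: "'a \<Rightarrow> nat" where g: "inj_on g V"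
    using finite_imp_inj_to_nat_seg[OF \<open>finite V\<close>] by blast
  define c where "c x \<longleftrightarrow> (\<exists>y. R x y \<and> (R y x \<longrightarrow> g x < g y))" for x
  have "c x \<noteq> c y" if xy: "R x y" for x y
  proof (cases "R y x")
    case False
    then show ?thesis
      using xy returns unfolding c_def by blast
  next
    case True
    \<comment> \<open>\<open>x\<close> and \<open>y\<close> are each other's only successors, so \<open>c\<close> compares just their numbers\<close>
    then have "c x \<longleftrightarrow> g x < g y" "c y \<longleftrightarrow> g y < g x"
      using xy returns unfolding c_def by blast+
    moreover have "g x \<noteq> g y"
      using xy V irrefl g by (metis inj_onD)
    ultimately show ?thesis by auto
  qed
  then show ?thesis by blast
qed

lemma L_number_le:
  assumes "L_labeling j k D f"
  shows "L_number j k D \<le> label_span D f"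
  unfolding L_number_def using assms by (intro Least_le) blast

lemma L_number_attained:
  assumes "digraph D"
  obtains f where "L_labeling j k D f" "label_span D f = L_number j k D"
proof -
  have "\<exists>s f. L_labeling j k D f \<and> label_span D f = s"
    using L_labeling_exists[OF assms] by blast
  from LeastI_ex[OF this] have "\<exists>f. L_labeling j k D f \<and> label_span D f = L_number j k D"
    unfolding L_number_def .
  then show thesis
    using that by blast
qed

lemma L_number_le_if_dipaths_short:
  assumes "strongly_simple_digraph D" "bipartite_digraph D"
    and short: "\<And>p. vpath p D \<Longrightarrow> vwalk_length p < 4"
    and "verts D \<noteq> {}"
  shows "L_number j k D \<le> j + 2 * k"
proof -
  interpret strongly_simple_digraph D by fact
  obtain B where B: "\<And>x y. x \<rightarrow>\<^bsub>D\<^esub> y \<Longrightarrow> x \<in> B \<longleftrightarrow> y \<notin> B"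
    using assms(2) by (rule bipartite_digraphE) blast
  have "\<exists>c :: 'a \<Rightarrow> bool. \<forall>x y. two_step D x y \<longrightarrow> c x \<noteq> c y"
  proof (rule two_coloring)
    show "finite (verts D)"
      by simp
    show "x \<in> verts D \<and> y \<in> verts D" if "two_step D x y" for x y
      using that by (auto simp: two_step_def)
    show "\<not> two_step D x x" for x
      using no_opposite_arcs by (auto simp: two_step_def)
    show "z = x" if "two_step D x y" "two_step D y z" for x y z
      using assms(1-3) that by (rule two_step_returns)
  qed
  then obtain c :: "'a \<Rightarrow> bool" where c: "\<forall>x y. two_step D x y \<longrightarrow> c x \<noteq> c y" ..
  \<comment> \<open>the side \<open>B\<close> uses \<open>{0, k}\<close> and the other one \<open>{j + k, j + 2k}\<close>: the gap \<open>j\<close> between the two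
    ranges settles the arcs, and \<open>c\<close> separates vertices of the same side at distance \<open>2\<close>\<close>
  define f where "f x = (if x \<in> B then 0 else j + k) + (if c x then k else 0)" for x
  have "L_labeling j k D f"
    unfolding L_labeling_def
  proof (intro ballI conjI impI)
    fix x y
    show "\<bar>int (f x) - int (f y)\<bar> \<ge> int j" if "x \<rightarrow>\<^bsub>D\<^esub> y"
      using B[OF that] by (auto simp: f_def)
    show "\<bar>int (f x) - int (f y)\<bar> \<ge> int k" if "didist D x y = 2"
    proof -
      have xy: "two_step D x y"
        using that by (rule two_step_if_didist_2)
      then have "x \<in> B \<longleftrightarrow> y \<in> B"
        using B unfolding two_step_def by blast
      moreover have "c x \<noteq> c y"
        using c xy by simp
      ultimately show ?thesis by (auto simp: f_def)
    qed
  qed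
  then have "L_number j k D \<le> label_span D f"
    by (rule L_number_le)
  also have "\<dots> \<le> Max (f ` verts D)"
    by (simp add: label_span_def)
  also have "\<dots> \<le> j + 2 * k"
    using \<open>verts D \<noteq> {}\<close> by (auto simp: f_def)
  finally show ?thesis .
qed

theorem theorem7:
  fixes D :: "('a,'b) pre_digraph" and j k :: nat
  assumes "0 < k" and "k \<le> j"
    and "strongly_simple_digraph D"
    and "bipartite_digraph D"
    and "longest_dipath_length D 3"
  shows "j + k \<le> L_number j k D \<and> L_number j k D \<le> j + 2 * k"
proof
  interpret strongly_simple_digraph D by fact
  obtain p where p: "vpath p D" "vwalk_length p = 3"
    and max: "\<And>q. vpath q D \<Longrightarrow> vwalk_length q \<le> 3"
    using assms(5) unfolding longest_dipath_length_def by blast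
  then obtain v0 v1 v2 v3 where "p = [v0, v1, v2, v3]"
    by (cases p) (auto simp: length_Suc_conv numeral_3_eq_3)
  with p have arcs: "v0 \<rightarrow>\<^bsub>D\<^esub> v1" "v1 \<rightarrow>\<^bsub>D\<^esub> v2"
    by (auto simp: vpath_def vwalk_def)
  then have "didist D v0 v2 = 2"
    using didist_eq_2_iff[OF assms(3,4)] unfolding two_step_def by blast
  moreover obtain f where "L_labeling j k D f" "label_span D f = L_number j k D"
    using L_number_attained digraph_axioms by blast
  ultimately show "j + k \<le> L_number j k D"
    using label_span_ge arcs \<open>k \<le> j\<close> digraph_axioms by metis
  show "L_number j k D \<le> j + 2 * k"
  proof (rule L_number_le_if_dipaths_short[OF assms(3,4)])
    show "vwalk_length q < 4" if "vpath q D" for q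
      using max[OF that] by simp
    show "verts D \<noteq> {}"
      using arcs(1) adj_in_verts(1) by blast
  qed
qed

end
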